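(* Let $(S,\Sigma,\mu)$ be a $\sigma$-finite measure space, let $b\in L^\infty(S,\Sigma,\mu)$ satisfy $0<b(s)\le \overline b<\infty$ for $\mu$-almost every $s\in S$ (for some constant $\overline b$) and $\operatorname{essinf}_{s\in S} b(s)=0$, and let $\delta>0$. Let $\varphi$ be an index function, and suppose that $f\in L^2(S,\Sigma,\mu)$ satisfies the source condition with respect to $\varphi$ and $b$. Let $(\Phi_\alpha)_{\alpha>0}$ be a regularization (with constants $C_{-1}$, $C_0$) that has qualification $\varphi$ (with constant $C_\varphi$). Let the data be $g^\delta=b f+\delta\xi$ with deterministic noise $\xi$, $\|\xi\|_{L^2(S,\Sigma,\mu)}\le 1$, and let $f^\delta_\alpha:=\Phi_\alpha(b)\,g^\delta$. Then $$\|f-f^\delta_\alpha\|_{L^2(S,\Sigma,\mu)}\le C_\varphi\,\varphi(\alpha)+C_{-1}\frac{\delta}{\alpha},\qquad \alpha>0.$$ Moreover, the a priori parameter choice $\alpha_*=\alpha_*(\varphi,\delta)$ obtained by solving the equation $\alpha\,\varphi(\alpha)=\delta$ yields, for $\alpha=\alpha_*$, the error bound $$\|f-f^\delta_{\alpha_*}\|_{L^2(S,\Sigma,\mu)}\le 2\max\{C_\varphi,C_{-1}\}\,\varphi(\alpha_* ),$$ uniformly over all functions $f$ which obey the source condition with respect to the index function $\varphi$ (and $b$).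
   Context: An index function is a strictly increasing continuous function $\varphi:(0,\infty)\to[0,\infty)$ with $\lim_{t\to+0}\varphi(t)=0$; one sets $\varphi(0):=0$. Source condition: $f\in L^2(S,\Sigma,\mu)$ obeys a source condition with respect to the index function $\varphi$ and the multiplier function $b$ if $f(s)=\varphi(b(s))\,v(s)$ for $\mu$-a.e. $s\in S$, for some $v$ with $\|v\|_{L^2(S,\Sigma,\mu)}\le 1$. Regularization: a family $(\Phi_\alpha)_{\alpha>0}$ of real-valued Borel-measurable functions $\Phi_\alpha(t)$, $t\ge 0$, is called a regularization if there are constants $C_{-1}>0$ and $C_0\ge 1$ such that (I) for each $t>0$, $t\Phi_\alpha(t)\to 1$ as $\alpha\to 0$; (II) $|\Phi_\alpha(t)|\le C_{-1}/\alpha$ for all $t\ge0$ and $\alpha>0$; (III) the residual function $R_\alpha(t):=1-t\Phi_\alpha(t)$ satisfies $|R_\alpha(t)|\le C_0$ for all $t\ge 0$ and $\alpha>0$. Qualification: a regularization $(\Phi_\alpha)$ has qualification $\varphi$ (an index function) if there is a constant $C_\varphi>0$ such that $\sup_{t\ge 0}|R_\alpha(t)|\,\varphi(t)\le C_\varphi\,\varphi(\alpha)$ for all $\alpha>0$. Notation: $[\Phi_\alpha(b)](s):=\Phi_\alpha(b(s))$, so $f^\delta_\alpha(s)=\Phi_\alpha(b(s))\,g^\delta(s)$. *)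

theory Defs
  imports "HOL-Probability.Essential_Supremum"
begin

(* Scalars range over class real_normed_field: up to isomorphism its instances are exactly
   the real and the complex numbers, so both versions of the L2 space are covered. *)

definition L2_space ::
    "'s measure \<Rightarrow> ('s \<Rightarrow> 'k::{real_normed_field, second_countable_topology}) set" where
  "L2_space M = {f \<in> borel_measurable M. integrable M (\<lambda>s. (norm (f s))\<^sup>2)}"

(* Only meaningful on L2_space M: the Bochner integral of a non-integrable function is 0. *)
definition L2_norm ::
    "'s measure \<Rightarrow> ('s \<Rightarrow> 'k::{real_normed_field, second_countable_topology}) \<Rightarrow> real" where
  "L2_norm M f = sqrt (\<integral>s. (norm (f s))\<^sup>2 \<partial>M)"

definition essinf :: "'s measure \<Rightarrow> ('s \<Rightarrow> real) \<Rightarrow> ereal" where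
  "essinf M b = - esssup M (\<lambda>s. - ereal (b s))"

definition index_function :: "(real \<Rightarrow> real) \<Rightarrow> bool" where
  "index_function \<phi> \<longleftrightarrow>
     (\<forall>t>0. 0 \<le> \<phi> t) \<and> strict_mono_on {0<..} \<phi> \<and> continuous_on {0<..} \<phi> \<and>
     (\<phi> \<longlongrightarrow> 0) (at_right 0) \<and> \<phi> 0 = 0"

definition source_condition ::
    "'s measure \<Rightarrow> (real \<Rightarrow> real) \<Rightarrow> ('s \<Rightarrow> real) \<Rightarrow>
     ('s \<Rightarrow> 'k::{real_normed_field, second_countable_topology}) \<Rightarrow> bool" where
  "source_condition M \<phi> b f \<longleftrightarrow>
     f \<in> L2_space M \<and>
     (\<exists>v \<in> L2_space M. L2_norm M v \<le> 1 \<and> (AE s in M. f s = of_real (\<phi> (b s)) * v s))"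

definition residual :: "(real \<Rightarrow> real \<Rightarrow> real) \<Rightarrow> real \<Rightarrow> real \<Rightarrow> real" where
  "residual \<Phi> \<alpha> t = 1 - t * \<Phi> \<alpha> t"

(* The parameters Cm1 and C0 are the constants written C_{-1} and C_0 in the literature.
   Values of \<Phi> \<alpha> t for \<alpha> \<le> 0 or t < 0 are irrelevant. *)
definition regularization :: "(real \<Rightarrow> real \<Rightarrow> real) \<Rightarrow> real \<Rightarrow> real \<Rightarrow> bool" where
  "regularization \<Phi> Cm1 C0 \<longleftrightarrow>
     0 < Cm1 \<and> 1 \<le> C0 \<and>
     (\<forall>\<alpha>>0. \<Phi> \<alpha> \<in> borel_measurable (restrict_space borel {0..})) \<and>
     (\<forall>t>0. ((\<lambda>\<alpha>. t * \<Phi> \<alpha> t) \<longlongrightarrow> 1) (at_right 0)) \<and>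
     (\<forall>t\<ge>0. \<forall>\<alpha>>0. \<bar>\<Phi> \<alpha> t\<bar> \<le> Cm1 / \<alpha>) \<and>
     (\<forall>t\<ge>0. \<forall>\<alpha>>0. \<bar>residual \<Phi> \<alpha> t\<bar> \<le> C0)"

definition has_qualification ::
    "(real \<Rightarrow> real \<Rightarrow> real) \<Rightarrow> (real \<Rightarrow> real) \<Rightarrow> real \<Rightarrow> bool" where
  "has_qualification \<Phi> \<phi> C \<longleftrightarrow>
     index_function \<phi> \<and> 0 < C \<and>
     (\<forall>\<alpha>>0. (SUP t\<in>{0..}. ereal (\<bar>residual \<Phi> \<alpha> t\<bar> * \<phi> t)) \<le> ereal (C * \<phi> \<alpha>))"

definition noisy_data ::
    "('s \<Rightarrow> real) \<Rightarrow> real \<Rightarrow> ('s \<Rightarrow> 'k) \<Rightarrow> ('s \<Rightarrow> 'k) \<Rightarrow> 's \<Rightarrow> 'k::real_normed_field" where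
  "noisy_data b \<delta> f \<xi> s = of_real (b s) * f s + of_real \<delta> * \<xi> s"

(* The function \<Phi> \<alpha> is specified (and measurable) on [0,\<infinity>) only, whereas a representative
   of b may be negative on a null set; there the multiplier is set to 0 so that the result
   is measurable. *)
definition reg_multiplier :: "(real \<Rightarrow> real \<Rightarrow> real) \<Rightarrow> real \<Rightarrow> ('s \<Rightarrow> real) \<Rightarrow> 's \<Rightarrow> real" where
  "reg_multiplier \<Phi> \<alpha> b s = (if 0 \<le> b s then \<Phi> \<alpha> (b s) else 0)"

definition reg_solution ::
    "(real \<Rightarrow> real \<Rightarrow> real) \<Rightarrow> real \<Rightarrow> ('s \<Rightarrow> real) \<Rightarrow> ('s \<Rightarrow> 'k) \<Rightarrow> 's \<Rightarrow> 'k::real_normed_field" where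
  "reg_solution \<Phi> \<alpha> b g s = of_real (reg_multiplier \<Phi> \<alpha> b s) * g s"

end

theory Submission
  imports Defs
begin

text \<open>
  The multiplication operators act pointwise, so the error splits at each point \<open>s\<close> into a bias and
  a noise part, \<open>f - \<Phi>\<^sub>\<alpha>(b) (b f + \<delta> \<xi>) = R\<^sub>\<alpha>(b) f - \<delta> \<Phi>\<^sub>\<alpha>(b) \<xi>\<close>. Where \<open>f = \<phi>(b) v\<close> and
  \<open>b > 0\<close>, qualification bounds the first part by \<open>C\<^sub>\<phi> \<phi>(\<alpha>) |v|\<close>, and the growth bound on
  \<open>\<Phi>\<^sub>\<alpha>\<close> bounds the second by \<open>C\<^sub>-\<^sub>1 (\<delta>/\<alpha>) |\<xi>|\<close> (lemma \<open>pointwise_error_bound\<close>). Both \<open>v\<close> and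
  \<open>\<xi>\<close> lie in the unit ball of \<open>L\<^sup>2\<close>, so the norm of the error is at most the sum of the two
  coefficients (lemma \<open>L2_norm_le_sum_of_coefficients\<close>).

  The function \<open>\<alpha> \<mapsto> \<alpha> \<phi>(\<alpha>)\<close> is continuous and strictly increasing from \<open>0\<close> to \<open>\<infinity>\<close>, so it takes
  the value \<open>\<delta>\<close> exactly once. At that \<open>\<alpha>\<close> one has \<open>\<delta>/\<alpha> = \<phi>(\<alpha>)\<close>: the two terms of the error bound
  are balanced, and their sum is at most \<open>2 max {C\<^sub>\<phi>, C\<^sub>-\<^sub>1} \<phi>(\<alpha>)\<close>.
\<close>

text \<open>
  Convexity of the square replaces Minkowski's inequality here:
  \<open>(A x + B y)\<^sup>2 \<le> (A + B) (A x\<^sup>2 + B y\<^sup>2)\<close>, the difference of the two sides being \<open>A B (x - y)\<^sup>2\<close>.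
  This gives the integrability of the left-hand side and, for \<open>v\<close> and \<open>w\<close> in the unit ball, the
  same bound \<open>A + B\<close>.
\<close>

lemma L2_norm_le_sum_of_coefficients:
  fixes u v w :: "'s \<Rightarrow> 'k::{real_normed_field, second_countable_topology}"
  assumes u: "u \<in> borel_measurable M"
    and v: "v \<in> L2_space M" "L2_norm M v \<le> 1"
    and w: "w \<in> L2_space M" "L2_norm M w \<le> 1"
    and nonneg: "0 \<le> A" "0 \<le> B"
    and bound: "AE s in M. norm (u s) \<le> A * norm (v s) + B * norm (w s)"
  shows "u \<in> L2_space M \<and> L2_norm M u \<le> A + B"
proof -
  define h where "h s = (A + B) * (A * (norm (v s))\<^sup>2 + B * (norm (w s))\<^sup>2)" for s
  have int: "integrable M (\<lambda>s. (norm (v s))\<^sup>2)" "integrable M (\<lambda>s. (norm (w s))\<^sup>2)"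
    using v w by (auto simp: L2_space_def)
  have h: "integrable M h"
    unfolding h_def using int by auto
  have le: "AE s in M. (norm (u s))\<^sup>2 \<le> h s"
    using bound
  proof eventually_elim
    case (elim s)
    have "(norm (u s))\<^sup>2 \<le> (A * norm (v s) + B * norm (w s))\<^sup>2"
      using elim by (intro power_mono) auto
    also have "\<dots> = h s - A * B * (norm (v s) - norm (w s))\<^sup>2"
      by (simp add: h_def power2_eq_square algebra_simps)
    also have "\<dots> \<le> h s"
      using nonneg by simp
    finally show ?case .
  qed
  have iu: "integrable M (\<lambda>s. (norm (u s))\<^sup>2)"
  proof (rule Bochner_Integration.integrable_bound[OF h])
    show "AE s in M. norm ((norm (u s))\<^sup>2) \<le> norm (h s)"
      using le by eventually_elim auto
  qed (use u in measurable)
  have "(\<integral>s. (norm (u s))\<^sup>2 \<partial>M) \<le> (\<integral>s. h s \<partial>M)"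
    by (rule integral_mono_AE[OF iu h le])
  also have "\<dots> = (A + B) * (A * (\<integral>s. (norm (v s))\<^sup>2 \<partial>M) + B * (\<integral>s. (norm (w s))\<^sup>2 \<partial>M))"
    unfolding h_def using int by simp
  also have "\<dots> \<le> (A + B) * (A * 1 + B * 1)"
    using v(2) w(2) nonneg by (intro mult_left_mono add_mono) (auto simp: L2_norm_def)
  finally have "L2_norm M u \<le> sqrt ((A + B)\<^sup>2)"
    unfolding L2_norm_def by (intro real_sqrt_le_mono) (simp add: power2_eq_square)
  then show ?thesis
    using u iu nonneg by (simp add: L2_space_def)
qed

lemma reg_multiplier_measurable:
  assumes b: "b \<in> borel_measurable M"
    and \<Phi>: "\<Phi> \<alpha> \<in> borel_measurable (restrict_space borel {0..})"
  shows "reg_multiplier \<Phi> \<alpha> b \<in> borel_measurable M"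
proof -
  have "(\<lambda>t. if t \<in> {0..} then \<Phi> \<alpha> t else 0) \<in> borel_measurable borel"
    using \<Phi> by (subst (asm) measurable_restrict_space_iff) auto
  from measurable_compose[OF b this] show ?thesis
    by (simp add: reg_multiplier_def[abs_def])
qed

lemma qualification_pointwise:
  assumes "has_qualification \<Phi> \<phi> C" "0 < \<alpha>" "0 \<le> t"
  shows "\<bar>residual \<Phi> \<alpha> t\<bar> * \<phi> t \<le> C * \<phi> \<alpha>"
  using assms by (auto simp: has_qualification_def SUP_le_iff)

text \<open>
  The first term is the bias \<open>R\<^sub>\<alpha>(b) f\<close> of exact data, where the source representation turns the
  residual into \<open>R\<^sub>\<alpha>(b) \<phi>(b)\<close>, the quantity that qualification controls; the second is the
  propagated noise \<open>\<delta> \<Phi>\<^sub>\<alpha>(b) \<xi>\<close>.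
\<close>

lemma pointwise_error_bound:
  fixes f :: "'s \<Rightarrow> 'k::real_normed_field"
  assumes reg: "regularization \<Phi> Cm1 C0"
    and qual: "has_qualification \<Phi> \<phi> C"
    and pos: "0 < \<alpha>" "0 \<le> \<delta>" "0 < b s"
    and source: "f s = of_real (\<phi> (b s)) * v s"
  shows "norm (f s - reg_solution \<Phi> \<alpha> b (noisy_data b \<delta> f \<xi>) s)
         \<le> C * \<phi> \<alpha> * norm (v s) + Cm1 * (\<delta> / \<alpha>) * norm (\<xi> s)"
proof -
  let ?R = "residual \<Phi> \<alpha> (b s)" and ?P = "\<Phi> \<alpha> (b s)"
  have \<phi>: "0 \<le> \<phi> (b s)"
    using qual pos by (auto simp: has_qualification_def index_function_def)
  have "f s - reg_solution \<Phi> \<alpha> b (noisy_data b \<delta> f \<xi>) s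
        = of_real (?R * \<phi> (b s)) * v s - of_real (\<delta> * ?P) * \<xi> s"
    using pos source
    by (simp add: reg_solution_def reg_multiplier_def noisy_data_def residual_def algebra_simps)
  also have "norm \<dots> \<le> (\<bar>?R\<bar> * \<phi> (b s)) * norm (v s) + (\<delta> * \<bar>?P\<bar>) * norm (\<xi> s)"
    using \<phi> pos by (intro order_trans[OF norm_triangle_ineq4]) (simp add: norm_mult abs_mult)
  also have "\<dots> \<le> (C * \<phi> \<alpha>) * norm (v s) + (\<delta> * (Cm1 / \<alpha>)) * norm (\<xi> s)"
    using qualification_pointwise[OF qual] reg pos
    by (intro add_mono mult_right_mono mult_left_mono) (auto simp: regularization_def)
  finally show ?thesis
    by (simp add: mult.commute)
qed

lemma regularization_error_bound:
  fixes f :: "'s \<Rightarrow> 'k::{real_normed_field, second_countable_topology}"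
  assumes b: "b \<in> borel_measurable M" "AE s in M. 0 < b s"
    and reg: "regularization \<Phi> Cm1 C0"
    and qual: "has_qualification \<Phi> \<phi> C"
    and source: "source_condition M \<phi> b f"
    and \<xi>: "\<xi> \<in> L2_space M" "L2_norm M \<xi> \<le> 1"
    and pos: "0 < \<alpha>" "0 \<le> \<delta>"
  shows "(\<lambda>s. f s - reg_solution \<Phi> \<alpha> b (noisy_data b \<delta> f \<xi>) s) \<in> L2_space M \<and>
         L2_norm M (\<lambda>s. f s - reg_solution \<Phi> \<alpha> b (noisy_data b \<delta> f \<xi>) s)
           \<le> C * \<phi> \<alpha> + Cm1 * (\<delta> / \<alpha>)"
proof -
  obtain v where v: "v \<in> L2_space M" "L2_norm M v \<le> 1"
    and fv: "AE s in M. f s = of_real (\<phi> (b s)) * v s"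
    using source by (auto simp: source_condition_def)
  have [measurable]: "f \<in> borel_measurable M" "\<xi> \<in> borel_measurable M" "b \<in> borel_measurable M"
    using source \<xi> b by (auto simp: source_condition_def L2_space_def)
  have [measurable]: "reg_multiplier \<Phi> \<alpha> b \<in> borel_measurable M"
    using b(1) reg pos by (intro reg_multiplier_measurable) (auto simp: regularization_def)
  show ?thesis
  proof (rule L2_norm_le_sum_of_coefficients[OF _ v \<xi>])
    show "(\<lambda>s. f s - reg_solution \<Phi> \<alpha> b (noisy_data b \<delta> f \<xi>) s) \<in> borel_measurable M"
      unfolding reg_solution_def noisy_data_def by measurable
    show "0 \<le> C * \<phi> \<alpha>"
      using qual pos by (auto simp: has_qualification_def index_function_def)
    show "0 \<le> Cm1 * (\<delta> / \<alpha>)"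
      using reg pos by (auto simp: regularization_def)
    show "AE s in M. norm (f s - reg_solution \<Phi> \<alpha> b (noisy_data b \<delta> f \<xi>) s)
            \<le> C * \<phi> \<alpha> * norm (v s) + Cm1 * (\<delta> / \<alpha>) * norm (\<xi> s)"
      using b(2) fv by eventually_elim (rule pointwise_error_bound[OF reg qual pos])
  qed
qed

lemma index_function_pos:
  assumes "index_function \<phi>" "0 < t"
  shows "0 < \<phi> t"
proof -
  have "\<phi> (t / 2) < \<phi> t" "0 \<le> \<phi> (t / 2)"
    using assms by (auto simp: index_function_def strict_mono_on_def)
  then show ?thesis by simp
qed

text \<open>
  Comparing \<open>\<phi>\<close> with its value at \<open>1\<close> brackets the solution: \<open>\<alpha> \<phi>(\<alpha>) \<le> \<alpha> \<phi>(1)\<close> for \<open>\<alpha> \<le> 1\<close>, with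
  the reverse inequality for \<open>\<alpha> \<ge> 1\<close>, so \<open>\<delta>\<close> is attained between \<open>min {1, \<delta>/\<phi>(1)}\<close> and
  \<open>max {1, \<delta>/\<phi>(1)}\<close>.
\<close>

lemma ex1_parameter_choice:
  assumes \<phi>: "index_function \<phi>" and \<delta>: "0 < \<delta>"
  shows "\<exists>!\<alpha>. 0 < \<alpha> \<and> \<alpha> * \<phi> \<alpha> = \<delta>"
proof (rule ex_ex1I)
  have mono: "\<phi> s \<le> \<phi> t" if "0 < s" "s \<le> t" for s t
    using \<phi> that by (cases "s = t") (auto simp: index_function_def strict_mono_on_def less_imp_le)
  have p1: "0 < \<phi> 1"
    by (rule index_function_pos[OF \<phi>]) simp
  define l u where "l = min 1 (\<delta> / \<phi> 1)" and "u = max 1 (\<delta> / \<phi> 1)"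
  have lu: "0 < l" "l \<le> 1" "1 \<le> u" "l \<le> u"
    using p1 \<delta> by (auto simp: l_def u_def)
  have "l * \<phi> l \<le> l * \<phi> 1"
    using lu mono by (intro mult_left_mono) auto
  also have "\<dots> \<le> (\<delta> / \<phi> 1) * \<phi> 1"
    using p1 by (intro mult_right_mono) (auto simp: l_def)
  finally have lower: "l * \<phi> l \<le> \<delta>"
    using p1 by simp
  have "(\<delta> / \<phi> 1) * \<phi> 1 \<le> u * \<phi> 1"
    using p1 by (intro mult_right_mono) (auto simp: u_def)
  also have "\<dots> \<le> u * \<phi> u"
    using lu mono by (intro mult_left_mono) auto
  finally have upper: "\<delta> \<le> u * \<phi> u"
    using p1 by simp
  have "continuous_on {l..u} \<phi>"
    using \<phi> lu by (auto simp: index_function_def intro: continuous_on_subset)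
  then have "continuous_on {l..u} (\<lambda>\<alpha>. \<alpha> * \<phi> \<alpha>)"
    by (intro continuous_intros)
  from IVT'[OF lower upper lu(4) this] obtain \<alpha> where "l \<le> \<alpha>" "\<alpha> * \<phi> \<alpha> = \<delta>"
    by blast
  with lu(1) show "\<exists>\<alpha>. 0 < \<alpha> \<and> \<alpha> * \<phi> \<alpha> = \<delta>"
    by (intro exI[of _ \<alpha>]) linarith
next
  have strict: "s * \<phi> s < t * \<phi> t" if "0 < s" "s < t" for s t
    using \<phi> that index_function_pos[OF \<phi>, of s]
    by (intro mult_strict_mono) (auto simp: index_function_def strict_mono_on_def)
  fix s t assume "0 < s \<and> s * \<phi> s = \<delta>" "0 < t \<and> t * \<phi> t = \<delta>"
  then show "s = t"
    using strict[of s t] strict[of t s] by (cases s t rule: linorder_cases) auto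
qed

theorem proposition3:
  fixes M :: "'s measure"
    and b :: "'s \<Rightarrow> real"
    and bbar \<delta> Cm1 C0 C\<phi> :: real
    and \<phi> :: "real \<Rightarrow> real"
    and \<Phi> :: "real \<Rightarrow> real \<Rightarrow> real"
  assumes "sigma_finite_measure M"
    and "b \<in> borel_measurable M"
    and "AE s in M. 0 < b s \<and> b s \<le> bbar"
    and "essinf M b = 0"
    and "0 < \<delta>"
    and "index_function \<phi>"
    and "regularization \<Phi> Cm1 C0"
    and "has_qualification \<Phi> \<phi> C\<phi>"
  shows
    "(\<forall>(f :: 's \<Rightarrow> 'k::{real_normed_field, second_countable_topology}) \<xi> \<alpha>.
        source_condition M \<phi> b f \<longrightarrow> \<xi> \<in> L2_space M \<longrightarrow> L2_norm M \<xi> \<le> 1 \<longrightarrow> 0 < \<alpha> \<longrightarrow>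
        (\<lambda>s. f s - reg_solution \<Phi> \<alpha> b (noisy_data b \<delta> f \<xi>) s) \<in> L2_space M \<and>
        L2_norm M (\<lambda>s. f s - reg_solution \<Phi> \<alpha> b (noisy_data b \<delta> f \<xi>) s)
          \<le> C\<phi> * \<phi> \<alpha> + Cm1 * (\<delta> / \<alpha>)) \<and>
     (\<exists>!\<alpha>. 0 < \<alpha> \<and> \<alpha> * \<phi> \<alpha> = \<delta>) \<and>
     (\<forall>\<alpha>s. 0 < \<alpha>s \<and> \<alpha>s * \<phi> \<alpha>s = \<delta> \<longrightarrow>
        (\<forall>(f :: 's \<Rightarrow> 'k) \<xi>.
           source_condition M \<phi> b f \<longrightarrow> \<xi> \<in> L2_space M \<longrightarrow> L2_norm M \<xi> \<le> 1 \<longrightarrow>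
           (\<lambda>s. f s - reg_solution \<Phi> \<alpha>s b (noisy_data b \<delta> f \<xi>) s) \<in> L2_space M \<and>
           L2_norm M (\<lambda>s. f s - reg_solution \<Phi> \<alpha>s b (noisy_data b \<delta> f \<xi>) s)
             \<le> 2 * max C\<phi> Cm1 * \<phi> \<alpha>s))"
proof (intro conjI allI impI)
  have b_pos: "AE s in M. 0 < b s"
    using assms(3) by eventually_elim simp
  note error = regularization_error_bound[OF assms(2) b_pos assms(7,8) _ _ _ _ less_imp_le[OF assms(5)]]
  {
    fix f \<xi> :: "'s \<Rightarrow> 'k" and \<alpha> :: real
    assume A: "source_condition M \<phi> b f" "\<xi> \<in> L2_space M" "L2_norm M \<xi> \<le> 1" "0 < \<alpha>"
    show "(\<lambda>s. f s - reg_solution \<Phi> \<alpha> b (noisy_data b \<delta> f \<xi>) s) \<in> L2_space M"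
      and "L2_norm M (\<lambda>s. f s - reg_solution \<Phi> \<alpha> b (noisy_data b \<delta> f \<xi>) s)
             \<le> C\<phi> * \<phi> \<alpha> + Cm1 * (\<delta> / \<alpha>)"
      using error[OF A] by auto
  }
  show "\<exists>!\<alpha>. 0 < \<alpha> \<and> \<alpha> * \<phi> \<alpha> = \<delta>"
    by (rule ex1_parameter_choice[OF assms(6,5)])
  {
    fix \<alpha>s :: real and f \<xi> :: "'s \<Rightarrow> 'k"
    assume \<alpha>s: "0 < \<alpha>s \<and> \<alpha>s * \<phi> \<alpha>s = \<delta>"
      and A: "source_condition M \<phi> b f" "\<xi> \<in> L2_space M" "L2_norm M \<xi> \<le> 1"
    note E = error[OF A conjunct1[OF \<alpha>s]]
    show "(\<lambda>s. f s - reg_solution \<Phi> \<alpha>s b (noisy_data b \<delta> f \<xi>) s) \<in> L2_space M"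
      using E by simp
    have balance: "\<delta> / \<alpha>s = \<phi> \<alpha>s"
      using \<alpha>s by (auto simp: field_simps)
    have "C\<phi> * \<phi> \<alpha>s + Cm1 * \<phi> \<alpha>s \<le> max C\<phi> Cm1 * \<phi> \<alpha>s + max C\<phi> Cm1 * \<phi> \<alpha>s"
      using index_function_pos[OF assms(6)] \<alpha>s
      by (intro add_mono mult_right_mono) (auto simp: less_imp_le)
    then show "L2_norm M (\<lambda>s. f s - reg_solution \<Phi> \<alpha>s b (noisy_data b \<delta> f \<xi>) s)
                 \<le> 2 * max C\<phi> Cm1 * \<phi> \<alpha>s"
      using E unfolding balance by linarith
  }
qed

end
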